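(* Let $J$ satisfy (A1)–(A3), let the admissible metric families $\mathcal D_1,\dots,\mathcal D_N$ satisfy (B1)–(B3), and let $\{x^k_{(N)}\}_{k\in\mathbb N}$, $x^k_{(N)}=(x_1^k,\dots,x_N^k)$, be the sequence generated by the iGGBPL algorithm with step sizes satisfying $\inf_{i\in[N],k\ge1}(\gamma_i^k-1)s_i^k>0$ and $\inf_{i\in[N],k\ge1}\sigma_i^k>0$ (all described in the context). Then: (i) there is a constant $\rho>0$ such that for all $k\ge 1$, $$J(x^{k+1}_{(N)})\le J(x^k_{(N)})-\rho\sum_{i=1}^N\big(d_i^k(x_i^{k+1},x_i^k)\big)^2;$$ (ii) $\lim_{k\to\infty}d_i^k(x_i^{k+1},x_i^k)=0$ for every $i\in[N]$.
   Context: Notation: $[N]=\{1,\dots,N\}$; $\langle\cdot,\cdot\rangle,\|\cdot\|$ are the Euclidean inner product and norm. Problem. Minimize $J(x_1,\dots,x_N)=H(x_1,\dots,x_N)+\sum_{i=1}^N F_i(x_i)$ over $\prod_{i=1}^N\mathbb R^{d_i}$. Assumptions: (A1) $H:\prod_i\mathbb R^{d_i}\to\mathbb R$ is continuously differentiable; for each $i$ and each choice of the other blocks, the partial gradient $x_i\mapsto\nabla_{x_i}H$ is Lipschitz on $\mathbb R^{d_i}$; and $\nabla H$ is Lipschitz on every bounded set. (A2) Each $F_i:\mathbb R^{d_i}\to(-\infty,+\infty]$ (equal to $+\infty$ outside a set $\mathbb D_{F_i}$) is proper, lower semicontinuous and bounded below. (A3) $J$ is a KŁ function, proper, coercive ($J(x)\to+\infty$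 as $\|x\|\to\infty$) and bounded below. Subdifferentials and KŁ. The Fréchet subdifferential $\hat\partial f(x)$ of a proper lsc $f$ at $x\in\mathrm{dom} f$ is the set of $u$ with $\liminf_{y\to x,y\ne x}\frac{f(y)-f(x)-\langle u,y-x\rangle}{\|y-x\|}\ge0$ (empty if $x\notin\mathrm{dom} f$); the limiting subdifferential is $\partial f(x)=\{u:\exists x^k\to x, f(x^k)\to f(x), u^k\in\hat\partial f(x^k), u^k\to u\}$. A desingularization function is a concave continuous $\phi:[0,\eta)\to\mathbb R_+$ with $\phi(0)=0$, continuously differentiable on $(0,\eta)$ with $\phi'>0$. $f$ is a KŁ function if for every $\bar u$ with $\partial f(\bar u)\neq\emptyset$ there exist $\eta\in(0,+\infty]$, a neighborhood $U$ of $\bar u$ and a desingularization function $\phi$ on $[0,\eta)$ such that $\phi'(f(u)-f(\bar u))\,\mathrm{dist}(0,\partial f(u))\ge1$ for all $u\in U$ with $f(\bar u)<f(u)<f(\bar u)+\eta$. Admissible metrics. For each $i\in[N]$, $\mathcal D_i$ is a family of metrics on $\mathbb R^{d_i}$ such that: (B1) there exist a norm $\|\cdot\|_d$ (on $\mathbb R^{d_i}$) and a constant $C_d>0$ with $C_d\|x-y\|_d\le d(x,y)$ for all $x,y\in\mathbb R^{d_i}$, $d\in\mathcal D_i$; (B2) $d(\cdot,y)$ is convex for every $y\in\mathbb R^{d_i}$, $d\in\mathcal D_i$; (B3) $\omega_i(x,y):=\sup_{d\in\mathcal D_i}d(x,y)$ is bounded on every compact subset of $\mathbb R^{d_i}\times\mathbb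 R^{d_i}$. iGGBPL algorithm. Input: $x^1_{(N)}=x^0_{(N)}\in\mathrm{dom}\,J$, $\rho_1>0$, $\beta^1=0$, $t_1=1$. For $k=1,2,3,\dots$: (1) Set $y_i^k=x_i^k+\beta^k(x_i^k-x_i^{k-1})$ for all $i$. (2) For $i=1,\dots,N$ successively: put $h_i(c)=H(x_1^{k+1},\dots,x_{i-1}^{k+1},c,x_{i+1}^k,\dots,x_N^k)$; choose any inner product $\langle u,v\rangle_{i,k}=\langle R_{i,k}u,v\rangle$ on $\mathbb R^{d_i}$ ($R_{i,k}$ symmetric positive definite) and any $d_i^k\in\mathcal D_i$; let $L_{i,k}>0$ be a constant such that $h_i(v)\le h_i(u)+\langle R_{i,k}^{-1}\nabla h_i(u),v-u\rangle_{i,k}+\frac{L_{i,k}}2(d_i^k(v,u))^2$ for all $u,v\in\mathbb R^{d_i}$; choose $s_i^k>L_{i,k}$, $\gamma_i^k>1$, $\sigma_i^k=1/(\gamma_i^ks_i^k)$; and choose $$x_i^{k+1}\in\arg\min_{x}\Big[F_i(x)+\tfrac1{2\sigma_i^k}(d_i^k(x,y_i^k))^2+\langle R_{i,k}^{-1}\nabla h_i(y_i^k),x-y_i^k\rangle_{i,k}\Big].$$ (3) If $J(x^{k+1}_{(N)})>J(x^k_{(N)})-\rho_1\sum_i(d_i^k(x_i^{k+1},x_i^k))^2$, set $\beta^k=0$ and redo (1)–(2) once (so that $y_i^k=x_i^k$); the result of this second pass is the final $x^{k+1}_{(N)}$. (4) $t_{k+1}=\frac{1+\sqrt{1+4t_k^2}}2$,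 $\beta^{k+1}=t_k/t_{k+1}$. All quantities with index $k$ refer to the pass that produced the final $x_{(N)}^{k+1}$. *)

theory Defs
  imports "HOL-Analysis.Analysis"
begin

section \<open>Variational notions for extended-real-valued functions\<close>

definition eff_dom :: "('a \<Rightarrow> ereal) \<Rightarrow> 'a set" where
  "eff_dom f = {x. f x < \<infinity>}"

definition proper_on :: "'a set \<Rightarrow> ('a \<Rightarrow> ereal) \<Rightarrow> bool" where
  "proper_on S f \<longleftrightarrow> (\<forall>x\<in>S. f x \<noteq> -\<infinity>) \<and> (\<exists>x\<in>S. f x < \<infinity>)"

definition lsc_on :: "'a::topological_space set \<Rightarrow> ('a \<Rightarrow> ereal) \<Rightarrow> bool" where
  "lsc_on S f \<longleftrightarrow> (\<forall>x\<in>S. f x \<le> Liminf (at x within S) f)"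

definition bounded_below_on :: "'a set \<Rightarrow> ('a \<Rightarrow> ereal) \<Rightarrow> bool" where
  "bounded_below_on S f \<longleftrightarrow> (\<exists>m::real. \<forall>x\<in>S. ereal m \<le> f x)"

definition coercive :: "('a::real_normed_vector \<Rightarrow> ereal) \<Rightarrow> bool" where
  "coercive f \<longleftrightarrow> (f \<longlongrightarrow> \<infinity>) at_infinity"

definition frechet_subdiff :: "('a::euclidean_space \<Rightarrow> ereal) \<Rightarrow> 'a \<Rightarrow> 'a set" where
  "frechet_subdiff f x =
     {u. x \<in> eff_dom f \<and>
         0 \<le> Liminf (at x) (\<lambda>y. (f y - f x - ereal (u \<bullet> (y - x))) / ereal (norm (y - x)))}"

definition limiting_subdiff :: "('a::euclidean_space \<Rightarrow> ereal) \<Rightarrow> 'a \<Rightarrow> 'a set" where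
  "limiting_subdiff f x =
     {u. \<exists>xs us. xs \<longlonglongrightarrow> x \<and> (\<lambda>k. f (xs k)) \<longlonglongrightarrow> f x \<and>
                 (\<forall>k::nat. us k \<in> frechet_subdiff f (xs k)) \<and> us \<longlonglongrightarrow> u}"

text \<open>The distance from the origin; in contrast to \<^const>\<open>infdist\<close>, it is infinite
  for the empty set.\<close>

definition dist_zero :: "'a::real_normed_vector set \<Rightarrow> ereal" where
  "dist_zero A = (INF u\<in>A. ereal (norm u))"

definition desingularization :: "ereal \<Rightarrow> (real \<Rightarrow> real) \<Rightarrow> bool" where
  "desingularization \<eta> \<phi> \<longleftrightarrow>
     concave_on {t. 0 \<le> t \<and> ereal t < \<eta>} \<phi> \<and>
     continuous_on {t. 0 \<le> t \<and> ereal t < \<eta>} \<phi> \<and>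
     (\<forall>t. 0 \<le> t \<and> ereal t < \<eta> \<longrightarrow> 0 \<le> \<phi> t) \<and>
     \<phi> 0 = 0 \<and>
     (\<forall>t. 0 < t \<and> ereal t < \<eta> \<longrightarrow> \<phi> differentiable (at t) \<and> 0 < deriv \<phi> t) \<and>
     continuous_on {t. 0 < t \<and> ereal t < \<eta>} (deriv \<phi>)"

definition KL_function :: "('a::euclidean_space \<Rightarrow> ereal) \<Rightarrow> bool" where
  "KL_function f \<longleftrightarrow>
     (\<forall>w. limiting_subdiff f w \<noteq> {} \<longrightarrow>
        (\<exists>\<eta> U \<phi>. 0 < \<eta> \<and> open U \<and> w \<in> U \<and> desingularization \<eta> \<phi> \<and>
           (\<forall>u\<in>U. f w < f u \<and> f u < f w + \<eta> \<longrightarrow>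
              1 \<le> ereal (deriv \<phi> (real_of_ereal (f u - f w))) * dist_zero (limiting_subdiff f u))))"

definition gradient :: "('a::real_inner \<Rightarrow> real) \<Rightarrow> 'a \<Rightarrow> 'a" where
  "gradient f x = (THE D. GDERIV f x :> D)"

definition continuously_differentiable :: "('a::real_inner \<Rightarrow> real) \<Rightarrow> bool" where
  "continuously_differentiable f \<longleftrightarrow>
     (\<forall>x. GDERIV f x :> gradient f x) \<and> continuous_on UNIV (gradient f)"


section \<open>Block structure\<close>

text \<open>The product of the Euclidean spaces \<open>\<real>\<^bsup>d\<^sub>i\<^esup>\<close> with \<open>i = 1, \<dots>, N\<close> is represented by
  \<^typ>\<open>real^'n\<close> together with a map \<open>blk :: 'n \<Rightarrow> nat\<close> assigning to each coordinate the
  number of its block, so that \<open>d\<^sub>i = card {j. blk j = i}\<close> and \<open>CARD('n) = d\<^sub>1 + \<dots> + d\<^sub>N\<close>.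
  The factor \<open>\<real>\<^bsup>d\<^sub>i\<^esup>\<close> is identified, isometrically, with the coordinate subspace of all
  vectors supported on block \<open>i\<close>.\<close>

definition block_space :: "('n::finite \<Rightarrow> nat) \<Rightarrow> nat \<Rightarrow> (real^'n) set" where
  "block_space blk i = {x. \<forall>j. blk j \<noteq> i \<longrightarrow> x $ j = 0}"

definition block :: "('n::finite \<Rightarrow> nat) \<Rightarrow> nat \<Rightarrow> real^'n \<Rightarrow> real^'n" where
  "block blk i x = (\<chi> j. if blk j = i then x $ j else 0)"

definition replace_block ::
    "('n::finite \<Rightarrow> nat) \<Rightarrow> nat \<Rightarrow> real^'n \<Rightarrow> real^'n \<Rightarrow> real^'n" where
  "replace_block blk i c z = (\<chi> j. if blk j = i then c $ j else z $ j)"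

text \<open>The function \<open>H(z\<^sub>1, \<dots>, z\<^bsub>i-1\<^esub>, c, z\<^bsub>i+1\<^esub>, \<dots>, z\<^sub>N)\<close> of \<open>c\<close>. As it depends on the
  block-\<open>i\<close> coordinates of \<open>c\<close> only, its \<^const>\<open>gradient\<close> lies in \<^term>\<open>block_space blk i\<close>
  and is the partial gradient of \<open>H\<close> with respect to the \<open>i\<close>-th block.\<close>

definition block_fun ::
    "('n::finite \<Rightarrow> nat) \<Rightarrow> (real^'n \<Rightarrow> real) \<Rightarrow> nat \<Rightarrow> real^'n \<Rightarrow> real^'n \<Rightarrow> real" where
  "block_fun blk H i z c = H (replace_block blk i c z)"

text \<open>Only the values of \<^term>\<open>F i\<close> on \<^term>\<open>block_space blk i\<close> matter.\<close>

definition objective ::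
    "nat \<Rightarrow> ('n::finite \<Rightarrow> nat) \<Rightarrow> (real^'n \<Rightarrow> real) \<Rightarrow> (nat \<Rightarrow> real^'n \<Rightarrow> ereal) \<Rightarrow> real^'n \<Rightarrow> ereal"
where
  "objective N blk H F x = ereal (H x) + (\<Sum>i=1..N. F i (block blk i x))"


section \<open>Standing assumptions\<close>

definition smooth_coupling :: "nat \<Rightarrow> ('n::finite \<Rightarrow> nat) \<Rightarrow> (real^'n \<Rightarrow> real) \<Rightarrow> bool" where
  "smooth_coupling N blk H \<longleftrightarrow>
     continuously_differentiable H \<and>
     (\<forall>i\<in>{1..N}. \<forall>z. \<exists>L. L-lipschitz_on (block_space blk i) (gradient (block_fun blk H i z))) \<and>
     (\<forall>B. bounded B \<longrightarrow> (\<exists>L. L-lipschitz_on B (gradient H)))"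

definition admissible_regularizers ::
    "nat \<Rightarrow> ('n::finite \<Rightarrow> nat) \<Rightarrow> (nat \<Rightarrow> real^'n \<Rightarrow> ereal) \<Rightarrow> bool" where
  "admissible_regularizers N blk F \<longleftrightarrow>
     (\<forall>i\<in>{1..N}. proper_on (block_space blk i) (F i) \<and> lsc_on (block_space blk i) (F i) \<and>
                 bounded_below_on (block_space blk i) (F i))"

definition admissible_objective :: "('a::euclidean_space \<Rightarrow> ereal) \<Rightarrow> bool" where
  "admissible_objective J \<longleftrightarrow>
     KL_function J \<and> proper_on UNIV J \<and> coercive J \<and> bounded_below_on UNIV J"

definition norm_on :: "'a::real_vector set \<Rightarrow> ('a \<Rightarrow> real) \<Rightarrow> bool" where
  "norm_on S p \<longleftrightarrow>
     (\<forall>x\<in>S. 0 \<le> p x \<and> (p x = 0 \<longleftrightarrow> x = 0)) \<and>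
     (\<forall>x\<in>S. \<forall>a. p (a *\<^sub>R x) = \<bar>a\<bar> * p x) \<and>
     (\<forall>x\<in>S. \<forall>y\<in>S. p (x + y) \<le> p x + p y)"

text \<open>An admissible family of metrics on the subspace \<open>E\<close>. The norm and the constant
  in the lower bound may depend on the metric.\<close>

definition admissible_metrics ::
    "'a::euclidean_space set \<Rightarrow> ('a \<Rightarrow> 'a \<Rightarrow> real) set \<Rightarrow> bool" where
  "admissible_metrics E \<D> \<longleftrightarrow>
     (\<forall>d\<in>\<D>. Metric_space E d) \<and>
     (\<forall>d\<in>\<D>. \<exists>p C. norm_on E p \<and> 0 < C \<and> (\<forall>x\<in>E. \<forall>y\<in>E. C * p (x - y) \<le> d x y)) \<and>
     (\<forall>d\<in>\<D>. \<forall>y\<in>E. convex_on E (\<lambda>x. d x y)) \<and>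
     (\<forall>K. compact K \<and> K \<subseteq> E \<times> E \<longrightarrow>
        (\<exists>M::real. \<forall>(x, y)\<in>K. (SUP d\<in>\<D>. ereal (d x y)) \<le> ereal M))"


section \<open>The algorithm\<close>

definition sym_pos_def_on :: "'a::real_inner set \<Rightarrow> ('a \<Rightarrow> 'a) \<Rightarrow> bool" where
  "sym_pos_def_on E R \<longleftrightarrow>
     linear R \<and> R ` E \<subseteq> E \<and>
     (\<forall>u\<in>E. \<forall>v\<in>E. R u \<bullet> v = u \<bullet> R v) \<and> (\<forall>u\<in>E. u \<noteq> 0 \<longrightarrow> 0 < R u \<bullet> u)"

text \<open>The choices made for one block in one pass: \<open>d\<^sub>i\<^sup>k\<close>, \<open>R\<^bsub>i,k\<^esub>\<close>, \<open>L\<^bsub>i,k\<^esub>\<close>, \<open>s\<^sub>i\<^sup>k\<close>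
  and \<open>\<gamma>\<^sub>i\<^sup>k\<close>.\<close>

record 'v block_choice =
  metric :: "'v \<Rightarrow> 'v \<Rightarrow> real"
  operator :: "'v \<Rightarrow> 'v"
  lip :: real
  inv_step :: real
  damp :: real

definition step_size :: "'v block_choice \<Rightarrow> real" where
  "step_size c = 1 / (damp c * inv_step c)"

definition weighted_inner :: "('v::real_inner \<Rightarrow> 'v) \<Rightarrow> 'v \<Rightarrow> 'v \<Rightarrow> real" where
  "weighted_inner R u v = R u \<bullet> v"

text \<open>The update of the \<open>i\<close>-th block, where \<open>h\<close> is the coupling term as a function of this
  block, \<open>y\<close> the extrapolated block and \<open>x'\<close> the new block.\<close>

definition block_update ::
    "'a::euclidean_space set \<Rightarrow> ('a \<Rightarrow> 'a \<Rightarrow> real) set \<Rightarrow> ('a \<Rightarrow> real) \<Rightarrow> ('a \<Rightarrow> ereal) \<Rightarrow>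
     'a block_choice \<Rightarrow> 'a \<Rightarrow> 'a \<Rightarrow> bool" where
  "block_update E \<D> h f c y x' \<longleftrightarrow>
     (let d = metric c; R = operator c; R_inv = inv_into E R in
        d \<in> \<D> \<and> sym_pos_def_on E R \<and> 0 < lip c \<and>
        (\<forall>u\<in>E. \<forall>v\<in>E. h v \<le> h u + weighted_inner R (R_inv (gradient h u)) (v - u)
                           + lip c / 2 * (d v u)\<^sup>2) \<and>
        lip c < inv_step c \<and> 1 < damp c \<and>
        is_arg_min (\<lambda>x. f x + ereal (1 / (2 * step_size c) * (d x y)\<^sup>2)
                            + ereal (weighted_inner R (R_inv (gradient h y)) (x - y)))
                   (\<lambda>x. x \<in> E) x')"

text \<open>One Gauss-Seidel sweep through all blocks with inertial parameter \<open>\<beta>\<close>. When block \<open>i\<close>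
  is updated, the blocks before \<open>i\<close> are taken from the new iterate \<open>x'\<close>.\<close>

definition pass ::
    "nat \<Rightarrow> ('n::finite \<Rightarrow> nat) \<Rightarrow> (real^'n \<Rightarrow> real) \<Rightarrow> (nat \<Rightarrow> real^'n \<Rightarrow> ereal) \<Rightarrow>
     (nat \<Rightarrow> (real^'n \<Rightarrow> real^'n \<Rightarrow> real) set) \<Rightarrow> real \<Rightarrow> real^'n \<Rightarrow> real^'n \<Rightarrow>
     (nat \<Rightarrow> (real^'n) block_choice) \<Rightarrow> real^'n \<Rightarrow> bool" where
  "pass N blk H F \<D> \<beta> x_prev x c x' \<longleftrightarrow>
     (\<forall>i\<in>{1..N}.
        block_update (block_space blk i) (\<D> i)
          (block_fun blk H i (\<chi> j. if blk j < i then x' $ j else x $ j)) (F i) (c i)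
          (block blk i x + \<beta> *\<^sub>R (block blk i x - block blk i x_prev)) (block blk i x'))"

definition sq_displacement ::
    "nat \<Rightarrow> ('n::finite \<Rightarrow> nat) \<Rightarrow> (nat \<Rightarrow> (real^'n) block_choice) \<Rightarrow> real^'n \<Rightarrow> real^'n \<Rightarrow> real" where
  "sq_displacement N blk c x' x =
     (\<Sum>i=1..N. (metric (c i) (block blk i x') (block blk i x))\<^sup>2)"

text \<open>One iteration: a trial pass which, if it fails the decrease test, is discarded and
  replaced by a pass without inertia (with possibly different choices). The resulting
  choices \<open>c\<close> are those of the pass that produced \<open>x'\<close>.\<close>

definition iteration ::
    "nat \<Rightarrow> ('n::finite \<Rightarrow> nat) \<Rightarrow> (real^'n \<Rightarrow> real) \<Rightarrow> (nat \<Rightarrow> real^'n \<Rightarrow> ereal) \<Rightarrow>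
     (nat \<Rightarrow> (real^'n \<Rightarrow> real^'n \<Rightarrow> real) set) \<Rightarrow> real \<Rightarrow> real \<Rightarrow> real^'n \<Rightarrow> real^'n \<Rightarrow>
     (nat \<Rightarrow> (real^'n) block_choice) \<Rightarrow> real^'n \<Rightarrow> bool" where
  "iteration N blk H F \<D> \<rho>\<^sub>1 \<beta> x_prev x c x' \<longleftrightarrow>
     (\<exists>c_trial x_trial.
        pass N blk H F \<D> \<beta> x_prev x c_trial x_trial \<and>
        (if objective N blk H F x_trial
              > objective N blk H F x - ereal (\<rho>\<^sub>1 * sq_displacement N blk c_trial x_trial x)
         then pass N blk H F \<D> 0 x_prev x c x'
         else c = c_trial \<and> x' = x_trial))"

text \<open>Here \<open>\<beta> k\<close> is the inertial parameter with which iteration \<open>k\<close> starts, before a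
  possible reset to \<open>0\<close>. The sequences \<open>\<beta>\<close>, \<open>t\<close> and \<open>c\<close> are relevant from index 1 on only.\<close>

definition iGGBPL ::
    "nat \<Rightarrow> ('n::finite \<Rightarrow> nat) \<Rightarrow> (real^'n \<Rightarrow> real) \<Rightarrow> (nat \<Rightarrow> real^'n \<Rightarrow> ereal) \<Rightarrow>
     (nat \<Rightarrow> (real^'n \<Rightarrow> real^'n \<Rightarrow> real) set) \<Rightarrow> real \<Rightarrow>
     (nat \<Rightarrow> nat \<Rightarrow> (real^'n) block_choice) \<Rightarrow> (nat \<Rightarrow> real^'n) \<Rightarrow> bool" where
  "iGGBPL N blk H F \<D> \<rho>\<^sub>1 c x \<longleftrightarrow>
     0 < \<rho>\<^sub>1 \<and> x 1 = x 0 \<and> x 0 \<in> eff_dom (objective N blk H F) \<and>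
     (\<exists>\<beta> t :: nat \<Rightarrow> real.
        \<beta> 1 = 0 \<and> t 1 = 1 \<and>
        (\<forall>k\<ge>1. t (k + 1) = (1 + sqrt (1 + 4 * (t k)\<^sup>2)) / 2 \<and> \<beta> (k + 1) = t k / t (k + 1)) \<and>
        (\<forall>k\<ge>1. iteration N blk H F \<D> \<rho>\<^sub>1 (\<beta> k) (x (k - 1)) (x k) (c k) (x (k + 1))))"

end

(* A pass without inertia decreases J sufficiently: comparing the minimiser of the i-th
   subproblem with the old block and adding the descent inequality for H gives a decrease of
   (gamma s - L)/2 d^2 >= (gamma - 1) s/2 d^2 in block i, and the H-terms telescope along the
   Gauss-Seidel sweep. A pass with inertia is kept only if J decreases by rho_1 times the same
   quantity. As J is bounded below, the squared displacements then tend to 0. *)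

theory Submission
  imports Defs
begin

lemma block_in_block_space [simp]: "block blk i x \<in> block_space blk i"
  by (simp add: block_def block_space_def)

text \<open>The subproblem and the descent inequality for \<open>h\<close> between \<open>y\<close>
  and \<open>x'\<close> contain the same linear term \<open>q\<close>, with opposite effect, so it
  cancels on adding. What remains is \<open>damp c * inv_step c / 2\<close> against
  \<open>lip c / 2\<close>, and \<open>lip c < inv_step c\<close> turns the difference into the gap
  \<open>(damp c - 1) * inv_step c / 2\<close>.\<close>

lemma block_update_descent:
  assumes upd: "block_update E \<D> h f c y x'"
    and metr: "\<And>d. d \<in> \<D> \<Longrightarrow> Metric_space E d"
    and y: "y \<in> E" and fy: "f y = ereal a" and fx': "f x' \<noteq> -\<infinity>"
  shows "\<exists>a'. f x' = ereal a' \<and>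
    a' + h x' \<le> a + h y - (damp c - 1) * inv_step c / 2 * (metric c x' y)\<^sup>2"
proof -
  define d where "d = metric c"
  define q where "q = weighted_inner (operator c) (inv_into E (operator c) (gradient h y)) (x' - y)"
  let ?m = "\<lambda>x. f x + ereal (1 / (2 * step_size c) * (d x y)\<^sup>2)
    + ereal (weighted_inner (operator c) (inv_into E (operator c) (gradient h y)) (x - y))"
  have dD: "d \<in> \<D>" and L: "lip c < inv_step c"
    and h: "\<And>u v. u \<in> E \<Longrightarrow> v \<in> E \<Longrightarrow> h v \<le> h u +
      weighted_inner (operator c) (inv_into E (operator c) (gradient h u)) (v - u)
      + lip c / 2 * (d v u)\<^sup>2"
    and am: "is_arg_min ?m (\<lambda>x. x \<in> E) x'"
    using upd by (simp_all add: block_update_def Let_def d_def)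
  have x': "x' \<in> E" and "?m x' \<le> ?m y"
    using am y by (auto simp: is_arg_min_def not_less)
  moreover have "d y y = 0"
    using Metric_space.zero[OF metr[OF dD] y y] by simp
  \<comment> \<open>At the competitor \<open>y\<close> both added terms vanish, and 1/(2
    \<open>step_size c\<close>) equals \<open>damp c * inv_step c / 2\<close>.\<close>
  ultimately have le:
    "f x' + ereal (damp c * inv_step c / 2 * (d x' y)\<^sup>2) + ereal q \<le> ereal a"
    by (simp add: fy step_size_def weighted_inner_def q_def mult.commute)
  \<comment> \<open>The real bound in \<open>le\<close> rules out the value plus infinity.\<close>
  then obtain a' where a': "f x' = ereal a'"
    using fx' by (cases "f x'") auto
  have "a' + damp c * inv_step c / 2 * (d x' y)\<^sup>2 + q \<le> a"
    using le a' by simp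
  moreover have "h x' \<le> h y + q + lip c / 2 * (d x' y)\<^sup>2"
    using h[OF y x'] by (simp add: q_def)
  moreover have "lip c / 2 * (d x' y)\<^sup>2 \<le> inv_step c / 2 * (d x' y)\<^sup>2"
    using L by (intro mult_right_mono) auto
  ultimately have "a' + h x' \<le> a + h y - (damp c - 1) * inv_step c / 2 * (d x' y)\<^sup>2"
    by (simp add: algebra_simps diff_divide_distrib)
  with a' show ?thesis by (simp add: d_def)
qed

lemma objective_ereal:
  assumes "\<And>i. i \<in> {1..N} \<Longrightarrow> F i (block blk i x) = ereal (f i)"
  shows "objective N blk H F x = ereal (H x + (\<Sum>i=1..N. f i))"
proof -
  have "(\<Sum>i=1..N. F i (block blk i x)) = (\<Sum>i=1..N. ereal (f i))"
    using assms by (intro sum.cong) auto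
  then show ?thesis by (simp add: objective_def)
qed

text \<open>A finite sum in \<open>ereal\<close> is plus infinity as soon as one summand is, because
  plus infinity absorbs even minus infinity.\<close>

lemma finite_blocks_of_finite_objective:
  assumes "objective N blk H F x < \<infinity>" and "i \<in> {1..N}"
  shows "F i (block blk i x) \<noteq> \<infinity>"
  using assms by (auto simp: objective_def sum_Pinfty)

lemma pass_descent:
  fixes blk :: "'n::finite \<Rightarrow> nat"
  assumes blocks: "range blk \<subseteq> {1..N}"
    and proper: "\<And>i u. i \<in> {1..N} \<Longrightarrow> u \<in> block_space blk i \<Longrightarrow> F i u \<noteq> -\<infinity>"
    and metr: "\<And>i d. i \<in> {1..N} \<Longrightarrow> d \<in> \<D> i \<Longrightarrow> Metric_space (block_space blk i) d"
    and p: "pass N blk H F \<D> 0 x_prev x c x'"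
    and fin: "objective N blk H F x < \<infinity>"
    and g: "\<And>i. i \<in> {1..N} \<Longrightarrow> g \<le> (damp (c i) - 1) * inv_step (c i)"
  shows "objective N blk H F x' \<le> objective N blk H F x - ereal (g / 2 * sq_displacement N blk c x' x)"
proof -
  \<comment> \<open>The state of the sweep just before block \<open>m\<close> is updated: earlier
    blocks are new, the others old.\<close>
  define mix where "mix m = (\<chi> j. if blk j < m then x' $ j else x $ j)" for m
  define a where "a i = real_of_ereal (F i (block blk i x))" for i
  define d2 where "d2 i = (metric (c i) (block blk i x') (block blk i x))\<^sup>2" for i
  have a: "F i (block blk i x) = ereal (a i)" if "i \<in> {1..N}" for i
    using finite_blocks_of_finite_objective[of N blk H F x i, OF fin that] proper[OF that, of "block blk i x"]
    by (auto simp: a_def ereal_real)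
  have "\<exists>a'. F i (block blk i x') = ereal a' \<and>
      a' + H (mix (Suc i)) \<le> a i + H (mix i) - g / 2 * d2 i"
    if i: "i \<in> {1..N}" for i
  proof -
    have "block_update (block_space blk i) (\<D> i) (block_fun blk H i (mix i)) (F i) (c i)
        (block blk i x) (block blk i x')"
      using p i by (simp add: pass_def mix_def)
    from block_update_descent[OF this metr[OF i] block_in_block_space a[OF i] proper[OF i]]
    obtain a' where a': "F i (block blk i x') = ereal a'"
      "a' + block_fun blk H i (mix i) (block blk i x') \<le> a i + block_fun blk H i (mix i) (block blk i x)
        - (damp (c i) - 1) * inv_step (c i) / 2 * d2 i"
      by (auto simp: d2_def)
    \<comment> \<open>The two values of the coupling term in block \<open>i\<close> are thus values
      of \<open>H\<close> at consecutive states of the sweep.\<close>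
    have "replace_block blk i (block blk i x') (mix i) = mix (Suc i)"
      "replace_block blk i (block blk i x) (mix i) = mix i"
      by (auto simp: replace_block_def block_def mix_def vec_eq_iff less_Suc_eq)
    moreover have "g / 2 * d2 i \<le> (damp (c i) - 1) * inv_step (c i) / 2 * d2 i"
      using g[OF i] by (intro mult_right_mono) (auto simp: d2_def)
    ultimately show ?thesis
      using a' by (auto simp: block_fun_def)
  qed
  \<comment> \<open>The inequality is rearranged to isolate the difference of \<open>H\<close> that
    telescopes.\<close>
  then obtain a' where a': "\<And>i. i \<in> {1..N} \<Longrightarrow> F i (block blk i x') = ereal (a' i)"
    and le: "\<And>i. i \<in> {1..N} \<Longrightarrow> a' i + (H (mix (Suc i)) - H (mix i)) \<le> a i - g / 2 * d2 i"
    by (metis (no_types, lifting) add_diff_eq diff_le_eq diff_add_eq)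
  \<comment> \<open>Every coordinate lies in a numbered block, so the sweep starts at
    \<open>x\<close> and ends at \<open>x'\<close>.\<close>
  have "1 \<le> blk j \<and> blk j \<le> N" for j
    using blocks by (simp add: image_subset_iff)
  then have "mix 1 = x" "mix (Suc N) = x'"
    by (auto simp: mix_def vec_eq_iff less_Suc_eq_le not_less[symmetric])
  moreover have "(\<Sum>i=1..N. a' i + (H (mix (Suc i)) - H (mix i))) \<le> (\<Sum>i=1..N. a i - g / 2 * d2 i)"
    by (intro sum_mono le)
  moreover have "(\<Sum>i=1..N. H (mix (Suc i)) - H (mix i)) = H (mix (Suc N)) - H (mix 1)"
    by (rule sum_Suc_diff) simp
  ultimately have "(\<Sum>i=1..N. a' i) + H x' \<le> (\<Sum>i=1..N. a i) + H x - g / 2 * (\<Sum>i=1..N. d2 i)"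
    unfolding sum.distrib sum_subtractf[of a] sum_distrib_left by simp
  then show ?thesis
    using objective_ereal[of N F blk x a H, OF a] objective_ereal[of N F blk x' a' H, OF a']
    by (simp add: sq_displacement_def d2_def algebra_simps)
qed

text \<open>The recorded choices stem from an actual pass, inertial or not, and there 0 <
  \<open>lip\<close> < \<open>inv_step\<close>. This later shows that the step size gaps are bounded
  below.\<close>

lemma iteration_admissible_choice:
  assumes "iteration N blk H F \<D> \<rho>\<^sub>1 \<beta> x_prev x c x'" and "i \<in> {1..N}"
  shows "0 < inv_step (c i)" and "1 < damp (c i)"
proof -
  obtain \<beta>' where "pass N blk H F \<D> \<beta>' x_prev x c x'"
    using assms(1) by (auto simp: iteration_def split: if_splits)
  with assms(2) show "0 < inv_step (c i)" "1 < damp (c i)"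
    by (auto simp: pass_def block_update_def Let_def intro: less_trans)
qed

lemma iteration_descent:
  fixes blk :: "'n::finite \<Rightarrow> nat"
  assumes blocks: "range blk \<subseteq> {1..N}"
    and proper: "\<And>i u. i \<in> {1..N} \<Longrightarrow> u \<in> block_space blk i \<Longrightarrow> F i u \<noteq> -\<infinity>"
    and metr: "\<And>i d. i \<in> {1..N} \<Longrightarrow> d \<in> \<D> i \<Longrightarrow> Metric_space (block_space blk i) d"
    and it: "iteration N blk H F \<D> \<rho>\<^sub>1 \<beta> x_prev x c x'"
    and fin: "objective N blk H F x < \<infinity>"
    and g: "\<And>i. i \<in> {1..N} \<Longrightarrow> g \<le> (damp (c i) - 1) * inv_step (c i)"
  shows "objective N blk H F x' \<le>
    objective N blk H F x - ereal (min \<rho>\<^sub>1 (g / 2) * sq_displacement N blk c x' x)"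
proof -
  let ?D = "sq_displacement N blk c x' x"
  \<comment> \<open>A retained trial pass satisfies the first alternative by the decrease test; a
    repeated pass has no inertia and satisfies the second.\<close>
  have "objective N blk H F x' \<le> objective N blk H F x - ereal (\<rho>\<^sub>1 * ?D) \<or>
    objective N blk H F x' \<le> objective N blk H F x - ereal (g / 2 * ?D)"
    using it pass_descent[OF blocks proper metr _ fin g]
    by (auto simp: iteration_def not_less split: if_splits)
  moreover have "0 \<le> ?D"
    by (auto simp: sq_displacement_def intro: sum_nonneg)
  then have "min \<rho>\<^sub>1 (g / 2) * ?D \<le> \<rho>\<^sub>1 * ?D" "min \<rho>\<^sub>1 (g / 2) * ?D \<le> g / 2 * ?D"
    by (intro mult_right_mono min.cobounded1 min.cobounded2, assumption)+
  ultimately show ?thesis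
    by (meson ereal_less_eq(3) ereal_minus_mono order_refl order_trans)
qed

text \<open>\<open>J\<close> is decreasing and bounded below, hence convergent, so its consecutive
  differences tend to 0; divided by \<rho>, they dominate \<open>D\<close>.\<close>

lemma sufficient_decrease_imp_tendsto_zero:
  fixes J D :: "nat \<Rightarrow> real"
  assumes \<rho>: "0 < \<rho>" and D: "\<And>k. 0 \<le> D k"
    and dec: "\<And>k. J (Suc k) \<le> J k - \<rho> * D k" and bdd: "\<And>k. m \<le> J k"
  shows "D \<longlonglongrightarrow> 0"
proof -
  have "decseq J"
    by (rule decseq_SucI) (use dec D \<rho> in \<open>smt (verit) mult_nonneg_nonneg\<close>)
  then obtain l where l: "J \<longlonglongrightarrow> l"
    using decseq_convergent[of J m] bdd by blast
  then have lim: "(\<lambda>k. (J k - J (Suc k)) / \<rho>) \<longlonglongrightarrow> 0"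
    using tendsto_divide[OF tendsto_diff[OF l LIMSEQ_Suc[OF l]] tendsto_const[of \<rho>]] \<rho> by simp
  have "D k \<le> (J k - J (Suc k)) / \<rho>" for k
    using dec[of k] \<rho> by (simp add: field_simps)
  then show ?thesis
    by (intro tendsto_sandwich[OF _ _ tendsto_const lim]) (auto intro: D always_eventually)
qed

theorem theorem1:
  fixes N :: nat
    and blk :: "'n::finite \<Rightarrow> nat"
    and H :: "real^'n \<Rightarrow> real"
    and F :: "nat \<Rightarrow> real^'n \<Rightarrow> ereal"
    and \<D> :: "nat \<Rightarrow> (real^'n \<Rightarrow> real^'n \<Rightarrow> real) set"
    and \<rho>\<^sub>1 :: real
    and c :: "nat \<Rightarrow> nat \<Rightarrow> (real^'n) block_choice"
    and x :: "nat \<Rightarrow> real^'n"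
  assumes blocks: "range blk \<subseteq> {1..N}"
    and A1: "smooth_coupling N blk H"
    and A2: "admissible_regularizers N blk F"
    and A3: "admissible_objective (objective N blk H F)"
    and B: "\<And>i. i \<in> {1..N} \<Longrightarrow> admissible_metrics (block_space blk i) (\<D> i)"
    and run: "iGGBPL N blk H F \<D> \<rho>\<^sub>1 c x"
    and gap: "0 < (INF (i, k)\<in>{1..N} \<times> {1..}. (damp (c k i) - 1) * inv_step (c k i))"
    and steps: "0 < (INF (i, k)\<in>{1..N} \<times> {1..}. step_size (c k i))"
  shows "(\<exists>\<rho>>0. \<forall>k\<ge>1. objective N blk H F (x (k + 1)) \<le> objective N blk H F (x k)
            - ereal (\<rho> * (\<Sum>i=1..N. (metric (c k i) (block blk i (x (k + 1))) (block blk i (x k)))\<^sup>2)))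
       \<and> (\<forall>i\<in>{1..N}. (\<lambda>k. metric (c k i) (block blk i (x (k + 1))) (block blk i (x k))) \<longlonglongrightarrow> 0)"
proof -
  define J where "J = objective N blk H F"
  define D where "D k = sq_displacement N blk (c k) (x (k + 1)) (x k)" for k
  define g where "g = (INF (i, k)\<in>{1..N} \<times> {1..}. (damp (c k i) - 1) * inv_step (c k i))"
  define \<rho> where "\<rho> = min \<rho>\<^sub>1 (g / 2)"
  have proper: "F i u \<noteq> -\<infinity>" if "i \<in> {1..N}" "u \<in> block_space blk i" for i u
    using A2 that by (auto simp: admissible_regularizers_def proper_on_def)
  have metr: "Metric_space (block_space blk i) d" if "i \<in> {1..N}" "d \<in> \<D> i" for i d
    using B[OF that(1)] that(2) by (auto simp: admissible_metrics_def)
  obtain m where m: "\<And>u. ereal m \<le> J u"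
    using A3 by (auto simp: admissible_objective_def bounded_below_on_def J_def)
  obtain \<beta> where it: "\<And>k. 1 \<le> k \<Longrightarrow>
      iteration N blk H F \<D> \<rho>\<^sub>1 (\<beta> k) (x (k - 1)) (x k) (c k) (x (k + 1))"
    and \<rho>\<^sub>1: "0 < \<rho>\<^sub>1" and start: "J (x 1) < \<infinity>"
    using run by (auto simp: iGGBPL_def eff_dom_def J_def)
  have pos: "0 \<le> (damp (c k i) - 1) * inv_step (c k i)" if "i \<in> {1..N}" "1 \<le> k" for i k
    using iteration_admissible_choice[OF it[OF that(2)] that(1)] by simp
  have g: "g \<le> (damp (c k i) - 1) * inv_step (c k i)" if "i \<in> {1..N}" "1 \<le> k" for i k
  \<comment> \<open>A real infimum is a lower bound only for a set that is bounded below;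
    \<open>pos\<close> supplies the bound 0.\<close>
  proof -
    have "bdd_below ((\<lambda>(i, k). (damp (c k i) - 1) * inv_step (c k i)) ` ({1..N} \<times> {1..}))"
      by (rule bdd_belowI2[where m = 0]) (use pos in auto)
    from cINF_lower[OF this, of "(i, k)"] that show ?thesis
      by (simp add: g_def)
  qed
  have \<rho>: "0 < \<rho>"
    using gap \<rho>\<^sub>1 by (simp add: \<rho>_def g_def)
  have dec: "J (x (k + 1)) \<le> J (x k) - ereal (\<rho> * D k)" if "1 \<le> k" "J (x k) < \<infinity>" for k
    using iteration_descent[OF blocks proper metr it[OF that(1)], of g] that g
    by (simp add: J_def D_def \<rho>_def)
  \<comment> \<open>Each application of \<open>dec\<close> presupposes a finite objective and passes
    finiteness on to the next iterate.\<close>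
  have fin: "J (x k) < \<infinity>" if "1 \<le> k" for k
    using that
  proof (induction k rule: dec_induct)
    case (step k)
    with dec[of k] show ?case
      by (cases "J (x k)") (auto simp: less_le_trans[OF _ m])
  qed (rule start)
  \<comment> \<open>Decrease holds only from iteration 1 on, so the real sequence is shifted by one;
    the limit of \<open>D\<close> is insensitive to the shift.\<close>
  define r where "r k = real_of_ereal (J (x (Suc k)))" for k
  have r: "J (x (Suc k)) = ereal (r k)" for k
    using fin[of "Suc k"] m[of "x (Suc k)"] by (cases "J (x (Suc k))") (auto simp: r_def)
  have "(\<lambda>k. D (Suc k)) \<longlonglongrightarrow> 0"
  proof (rule sufficient_decrease_imp_tendsto_zero[OF \<rho>])
    show "0 \<le> D (Suc k)" for k
      by (auto simp: D_def sq_displacement_def intro: sum_nonneg)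
    show "r (Suc k) \<le> r k - \<rho> * D (Suc k)" for k
      using dec[OF _ fin, of "Suc k"] by (simp add: r)
    show "m \<le> r k" for k
      using m[of "x (Suc k)"] by (simp add: r)
  qed
  then have D: "D \<longlonglongrightarrow> 0"
    by (simp add: LIMSEQ_imp_Suc)
  have "(\<lambda>k. metric (c k i) (block blk i (x (k + 1))) (block blk i (x k))) \<longlonglongrightarrow> 0"
    if i: "i \<in> {1..N}" for i
  proof -
    let ?d = "\<lambda>k. metric (c k i) (block blk i (x (k + 1))) (block blk i (x k))"
    \<comment> \<open>One block contributes a single summand of a sum of squares.\<close>
    have "(?d k)\<^sup>2 \<le> D k" for k
      using i unfolding D_def sq_displacement_def by (intro member_le_sum) auto
    then have "(\<lambda>k. (?d k)\<^sup>2) \<longlonglongrightarrow> 0"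
      by (intro tendsto_sandwich[OF _ _ tendsto_const D]) auto
    then show ?thesis
      by (simp add: tendsto_null_power)
  qed
  with \<rho> dec fin show ?thesis
    by (auto simp: J_def D_def sq_displacement_def intro!: exI[of _ \<rho>])
qed

end
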